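(* Let $(X,+,e,\varphi)$ be a module over a unitary ring $(A,+,\cdot,0,1)$. If $A$ contains $\tfrac12=(1+1)^{-1}$, then $(X,q)$ is an affine mobi space over the mobi algebra $(A,p,0,\tfrac12,1)$, where $$p(a,b,c)=a+bc-ba,\qquad q(x,a,y)=\varphi_{1-a}(x)+\varphi_a(y)$$ for all $a,b,c\in A$ and $x,y\in X$.
   Context: Rings are unitary and not necessarily commutative. A module over a ring $A$ is a system $(X,+,e,\varphi)$ where $(X,+,e)$ is an abelian group with identity $e$ and $\varphi\colon A\to\mathrm{End}(X)$, $a\mapsto\varphi_a$, is a homomorphism of unitary rings. A mobi algebra is a system $(A,p,0,\tfrac12,1)$ consisting of a set $A$, a ternary operation $p\colon A^3\to A$ and three constants $0,\tfrac12,1\in A$ such that for all elements of $A$: (A1) $p(1,\tfrac12,0)=\tfrac12$; (A2) $p(0,a,1)=a$; (A3) $p(a,b,a)=a$; (A4) $p(a,0,b)=a$; (A5) $p(b,1,a)=a$; (A6) $p(a,\tfrac12,b)=p(a,\tfrac12,c)\Rightarrow b=c$; (A7) $p(a,p(b_1,b_2,b_3),c)=p(p(a,b_1,c),b_2,p(a,b_3,c))$; (A8) $p(p(a_1,b,c_1),\tfrac12,p(a_2,b,c_2))=p(p(a_1,\tfrac12,a_2),b,p(c_1,\tfrac12,c_2))$. A mobi space over a mobi algebra $A$ is a pair $(X,q)$ with $X$ a set and $q\colon X\times A\times X\to X$ a map such that for all elements: (X1) $q(x,0,y)=x$; (X2) $q(y,1,x)=x$; (X3) $q(x,a,x)=x$;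 (X4) $q(x,\tfrac12,y)=q(x,\tfrac12,y')\Rightarrow y=y'$; (X5) $q(q(x,a,y),b,q(x,c,y))=q(x,p(a,b,c),y)$. It is affine if $q(q(x_1,a,y_1),\tfrac12,q(x_2,a,y_2))=q(q(x_1,\tfrac12,x_2),a,q(y_1,\tfrac12,y_2))$ for all $x_1,x_2,y_1,y_2\in X$, $a\in A$. *)

theory Defs
  imports "HOL-Algebra.Ring"
begin

text \<open>
  Endomorphisms are extensional functions, so that two of them are equal as soon as they agree
  on the carrier; only the additive part of \<open>X\<close> is used.
\<close>

definition endo_ring :: "('b, 'm) ring_scheme \<Rightarrow> ('b \<Rightarrow> 'b) ring"
  where "endo_ring X =
    \<lparr>carrier = hom (add_monoid X) (add_monoid X) \<inter> extensional (carrier X),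
     mult = compose (carrier X),
     one = (\<lambda>x\<in>carrier X. x),
     zero = (\<lambda>x\<in>carrier X. \<zero>\<^bsub>X\<^esub>),
     add = (\<lambda>f g. \<lambda>x\<in>carrier X. f x \<oplus>\<^bsub>X\<^esub> g x)\<rparr>"

lemma endo_ring_ring:
  assumes "abelian_group X"
  shows "ring (endo_ring X)"
proof -
  interpret X: abelian_group X by fact
  have hom_iff: "f \<in> hom (add_monoid X) (add_monoid X) \<longleftrightarrow> f \<in> carrier X \<rightarrow> carrier X \<and>
      (\<forall>x\<in>carrier X. \<forall>y\<in>carrier X. f (x \<oplus>\<^bsub>X\<^esub> y) = f x \<oplus>\<^bsub>X\<^esub> f y)" for f
    by (simp add: hom_def)
  have zero: "f \<zero>\<^bsub>X\<^esub> = \<zero>\<^bsub>X\<^esub>" if "f \<in> hom (add_monoid X) (add_monoid X)" for f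
    using X.add.is_group group_hom.hom_one[of "add_monoid X" "add_monoid X" f] that
    by (simp add: group_hom_def group_hom_axioms_def)
  show ?thesis
  proof (rule ringI)
    show "abelian_group (endo_ring X)"
    proof (rule abelian_groupI)
      fix f assume "f \<in> carrier (endo_ring X)"
      then show "\<exists>g\<in>carrier (endo_ring X). g \<oplus>\<^bsub>endo_ring X\<^esub> f = \<zero>\<^bsub>endo_ring X\<^esub>"
        by (intro bexI[of _ "\<lambda>x\<in>carrier X. \<ominus>\<^bsub>X\<^esub> f x"])
           (auto simp: endo_ring_def hom_iff X.l_neg X.minus_add Pi_iff)
    next
      fix f assume "f \<in> carrier (endo_ring X)"
      then show "\<zero>\<^bsub>endo_ring X\<^esub> \<oplus>\<^bsub>endo_ring X\<^esub> f = f"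
        by (auto simp: endo_ring_def hom_iff Pi_iff extensional_def)
    qed (auto simp: endo_ring_def hom_iff Pi_iff X.a_ac)
    show "monoid (endo_ring X)"
      by (rule monoidI)
         (auto simp: endo_ring_def hom_iff Pi_iff compose_def extensional_def fun_eq_iff)
  qed (auto simp: endo_ring_def hom_iff Pi_iff compose_def)
qed

text \<open>
  The library's module locale requires a commutative ring of scalars, hence a separate locale
  for modules over an arbitrary unitary ring.
\<close>

locale ring_module = ring A + X: abelian_group X
  for A :: "('a, 'm) ring_scheme" (structure) and X :: "('b, 'n) ring_scheme" (structure) +
  fixes \<phi> :: "'a \<Rightarrow> 'b \<Rightarrow> 'b"
  assumes action_hom: "\<phi> \<in> ring_hom A (endo_ring X)"

locale mobi_algebra =
  fixes A :: "'a set"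
    and p :: "'a \<Rightarrow> 'a \<Rightarrow> 'a \<Rightarrow> 'a"
    and zero :: 'a
    and half :: 'a
    and one :: 'a
  assumes p_closed: "\<lbrakk>a \<in> A; b \<in> A; c \<in> A\<rbrakk> \<Longrightarrow> p a b c \<in> A"
    and zero_closed: "zero \<in> A"
    and half_closed: "half \<in> A"
    and one_closed: "one \<in> A"
    and A1: "p one half zero = half"
    and A2: "a \<in> A \<Longrightarrow> p zero a one = a"
    and A3: "\<lbrakk>a \<in> A; b \<in> A\<rbrakk> \<Longrightarrow> p a b a = a"
    and A4: "\<lbrakk>a \<in> A; b \<in> A\<rbrakk> \<Longrightarrow> p a zero b = a"
    and A5: "\<lbrakk>a \<in> A; b \<in> A\<rbrakk> \<Longrightarrow> p b one a = a"
    and A6: "\<lbrakk>a \<in> A; b \<in> A; c \<in> A; p a half b = p a half c\<rbrakk> \<Longrightarrow> b = c"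
    and A7: "\<lbrakk>a \<in> A; b\<^sub>1 \<in> A; b\<^sub>2 \<in> A; b\<^sub>3 \<in> A; c \<in> A\<rbrakk> \<Longrightarrow>
      p a (p b\<^sub>1 b\<^sub>2 b\<^sub>3) c = p (p a b\<^sub>1 c) b\<^sub>2 (p a b\<^sub>3 c)"
    and A8: "\<lbrakk>a\<^sub>1 \<in> A; a\<^sub>2 \<in> A; b \<in> A; c\<^sub>1 \<in> A; c\<^sub>2 \<in> A\<rbrakk> \<Longrightarrow>
      p (p a\<^sub>1 b c\<^sub>1) half (p a\<^sub>2 b c\<^sub>2) = p (p a\<^sub>1 half a\<^sub>2) b (p c\<^sub>1 half c\<^sub>2)"

locale mobi_space = mobi_algebra A p zero half one
  for A :: "'a set" and p zero half one +
  fixes X :: "'b set"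
    and q :: "'b \<Rightarrow> 'a \<Rightarrow> 'b \<Rightarrow> 'b"
  assumes q_closed: "\<lbrakk>x \<in> X; a \<in> A; y \<in> X\<rbrakk> \<Longrightarrow> q x a y \<in> X"
    and X1: "\<lbrakk>x \<in> X; y \<in> X\<rbrakk> \<Longrightarrow> q x zero y = x"
    and X2: "\<lbrakk>x \<in> X; y \<in> X\<rbrakk> \<Longrightarrow> q y one x = x"
    and X3: "\<lbrakk>x \<in> X; a \<in> A\<rbrakk> \<Longrightarrow> q x a x = x"
    and X4: "\<lbrakk>x \<in> X; y \<in> X; y' \<in> X; q x half y = q x half y'\<rbrakk> \<Longrightarrow> y = y'"
    and X5: "\<lbrakk>x \<in> X; y \<in> X; a \<in> A; b \<in> A; c \<in> A\<rbrakk> \<Longrightarrow>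
      q (q x a y) b (q x c y) = q x (p a b c) y"

locale affine_mobi_space = mobi_space A p zero half one X q
  for A :: "'a set" and p zero half one and X :: "'b set" and q +
  assumes affine: "\<lbrakk>x\<^sub>1 \<in> X; x\<^sub>2 \<in> X; y\<^sub>1 \<in> X; y\<^sub>2 \<in> X; a \<in> A\<rbrakk> \<Longrightarrow>
    q (q x\<^sub>1 a y\<^sub>1) half (q x\<^sub>2 a y\<^sub>2) = q (q x\<^sub>1 half x\<^sub>2) a (q y\<^sub>1 half y\<^sub>2)"

end

theory Submission
  imports Defs
begin

text \<open>
  Since \<open>A\<close> acts on itself by left multiplication and \<open>p\<close> is the map \<open>q\<close> of that regular module,
  every axiom of a mobi algebra beyond (A1) and (A2) is an instance of a fact about \<open>q\<close> over an
  arbitrary module. The facts involving one half come from \<open>q(x, 1/2, y) = \<phi>(1/2)(x + y)\<close>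
  and from one half being central.
\<close>

lemma (in ring) half_unique:
  assumes "h \<in> carrier R" "h \<oplus> h = \<one>"
  shows "\<one> \<ominus> h = h"
  using assms by (metis add.inv_solve_right minus_eq one_closed)

text \<open>Doubling can be moved freely between the factors of a product: writing 1 as
  \<open>h \<oplus> h\<close> on the right of \<open>h \<otimes> a\<close> and shifting the doubling
  to the left factor turns \<open>h\<close> there into 1 and leaves
  \<open>a \<otimes> h\<close>.\<close>

lemma (in ring) half_central:
  assumes "h \<in> carrier R" "h \<oplus> h = \<one>" "a \<in> carrier R"
  shows "h \<otimes> a = a \<otimes> h"
proof -
  have "h \<otimes> a = h \<otimes> a \<otimes> (h \<oplus> h)" using assms by simp
  also have "\<dots> = (h \<otimes> a \<oplus> h \<otimes> a) \<otimes> h" using assms(1,3) by (simp add: l_distr r_distr)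
  also have "\<dots> = (h \<oplus> h) \<otimes> a \<otimes> h" using assms(1,3) by (simp add: l_distr)
  also have "\<dots> = a \<otimes> h" using assms by simp
  finally show ?thesis .
qed

text \<open>This turns invertibility of 1 + 1 into the equation
  \<open>h \<oplus> h = \<one>\<close>, the form in which one half enters all later
  arguments.\<close>

lemma (in ring) inv_two:
  assumes "\<one> \<oplus> \<one> \<in> Units R"
  shows "inv (\<one> \<oplus> \<one>) \<oplus> inv (\<one> \<oplus> \<one>) = \<one>"
proof -
  have c: "inv (\<one> \<oplus> \<one>) \<in> carrier R" using assms by simp
  then have "inv (\<one> \<oplus> \<one>) \<oplus> inv (\<one> \<oplus> \<one>) = inv (\<one> \<oplus> \<one>) \<otimes> (\<one> \<oplus> \<one>)"
    by (simp add: r_distr)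
  with assms show ?thesis by simp
qed

text \<open>Distributivity and associativity are exactly the laws of the action. Multiplication is
  restricted to the carrier because members of \<open>endo_ring\<close> are extensional.\<close>

lemma (in ring) regular_module:
  "ring_module R R (\<lambda>a. \<lambda>x\<in>carrier R. a \<otimes> x)"
proof unfold_locales
  show "(\<lambda>a. \<lambda>x\<in>carrier R. a \<otimes> x) \<in> ring_hom R (endo_ring R)"
    by (rule ring_hom_memI)
       (auto simp: endo_ring_def hom_def r_distr l_distr m_assoc compose_def fun_eq_iff)
qed

context ring_module
begin

lemma
  assumes "a \<in> carrier A"
  shows act_closed [simp]: "x \<in> carrier X \<Longrightarrow> \<phi> a x \<in> carrier X"
    and act_add_right: "\<lbrakk>x \<in> carrier X; y \<in> carrier X\<rbrakk> \<Longrightarrow> \<phi> a (x \<oplus>\<^bsub>X\<^esub> y) = \<phi> a x \<oplus>\<^bsub>X\<^esub> \<phi> a y"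
proof -
  have "\<phi> a \<in> hom (add_monoid X) (add_monoid X)"
    using ring_hom_closed[OF action_hom assms] by (simp add: endo_ring_def)
  then show "x \<in> carrier X \<Longrightarrow> \<phi> a x \<in> carrier X"
    and "\<lbrakk>x \<in> carrier X; y \<in> carrier X\<rbrakk> \<Longrightarrow> \<phi> a (x \<oplus>\<^bsub>X\<^esub> y) = \<phi> a x \<oplus>\<^bsub>X\<^esub> \<phi> a y"
    by (auto simp: hom_def)
qed

lemma act_add_left:
  assumes "a \<in> carrier A" "b \<in> carrier A" "x \<in> carrier X"
  shows "\<phi> (a \<oplus> b) x = \<phi> a x \<oplus>\<^bsub>X\<^esub> \<phi> b x"
  using ring_hom_add[OF action_hom assms(1,2)] assms(3) by (simp add: endo_ring_def)

lemma act_mult: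
  assumes "a \<in> carrier A" "b \<in> carrier A" "x \<in> carrier X"
  shows "\<phi> (a \<otimes> b) x = \<phi> a (\<phi> b x)"
  using ring_hom_mult[OF action_hom assms(1,2)] assms(3) by (simp add: endo_ring_def compose_def)

lemma act_one [simp]: "x \<in> carrier X \<Longrightarrow> \<phi> \<one> x = x"
  using ring_hom_one[OF action_hom] by (simp add: endo_ring_def)

lemma act_zero [simp]:
  assumes "x \<in> carrier X"
  shows "\<phi> \<zero> x = \<zero>\<^bsub>X\<^esub>"
  \<comment> \<open>Since 0 = 0 + 0, the element \<open>\<phi> \<zero> x\<close> equals its own
    double and cancels to zero.\<close>
  using act_add_left[of \<zero> \<zero> x] assms by (simp add: X.add.l_cancel_one')

text \<open>This is the map q of the theorem, defined for a general module so that it can be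
  instantiated both at \<open>X\<close> and at the ring acting on itself.\<close>

definition affine_comb :: "'b \<Rightarrow> 'a \<Rightarrow> 'b \<Rightarrow> 'b"
  where "affine_comb x a y = \<phi> (\<one> \<ominus> a) x \<oplus>\<^bsub>X\<^esub> \<phi> a y"

lemma affine_comb_closed [simp]:
  "\<lbrakk>x \<in> carrier X; a \<in> carrier A; y \<in> carrier X\<rbrakk> \<Longrightarrow> affine_comb x a y \<in> carrier X"
  by (simp add: affine_comb_def)

lemma affine_comb_zero:
  "\<lbrakk>x \<in> carrier X; y \<in> carrier X\<rbrakk> \<Longrightarrow> affine_comb x \<zero> y = x"
  by (simp add: affine_comb_def minus_eq)

lemma affine_comb_one:
  "\<lbrakk>x \<in> carrier X; y \<in> carrier X\<rbrakk> \<Longrightarrow> affine_comb y \<one> x = x"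
  by (simp add: affine_comb_def minus_eq r_neg)

text \<open>The coefficients 1 - a and a add up to 1.\<close>

lemma affine_comb_same:
  assumes "x \<in> carrier X" "a \<in> carrier A"
  shows "affine_comb x a x = x"
proof -
  have "\<one> \<ominus> a \<oplus> a = \<one>" using assms(2) by (simp add: minus_eq a_assoc l_neg)
  then show ?thesis
    using act_add_left[of "\<one> \<ominus> a" a x] assms by (simp add: affine_comb_def)
qed

text \<open>After expansion both sides are sums of a multiple of \<open>x\<close> and a multiple of
  \<open>y\<close>, so it suffices to compare coefficients in the ring: the facts \<open>x\<close>
  and \<open>y\<close> of the proof, with \<open>b\<close> always the left factor.\<close>

lemma affine_comb_affine_comb:
  assumes "x \<in> carrier X" "y \<in> carrier X" "a \<in> carrier A" "b \<in> carrier A" "c \<in> carrier A"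
  shows "affine_comb (affine_comb x a y) b (affine_comb x c y)
    = affine_comb x (a \<oplus> b \<otimes> c \<ominus> b \<otimes> a) y"
proof -
  have x: "\<one> \<ominus> (a \<oplus> b \<otimes> c \<ominus> b \<otimes> a) = (\<one> \<ominus> b) \<otimes> (\<one> \<ominus> a) \<oplus> b \<otimes> (\<one> \<ominus> c)"
    using assms(3-5) by algebra
  have y: "a \<oplus> b \<otimes> c \<ominus> b \<otimes> a = (\<one> \<ominus> b) \<otimes> a \<oplus> b \<otimes> c"
    using assms(3-5) by algebra
  show ?thesis
    \<comment> \<open>The order matters: the left side of \<open>y\<close> occurs inside the left
      side of \<open>x\<close>, so rewriting with \<open>y\<close> first would destroy the pattern
      of \<open>x\<close>.\<close>
    unfolding affine_comb_def x unfolding y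
    using assms by (simp add: act_add_left act_add_right act_mult X.a_ac)
qed

context
  fixes h
  assumes h: "h \<in> carrier A" "h \<oplus> h = \<one>"
begin

lemma affine_comb_half:
  "\<lbrakk>x \<in> carrier X; y \<in> carrier X\<rbrakk> \<Longrightarrow> affine_comb x h y = \<phi> h (x \<oplus>\<^bsub>X\<^esub> y)"
  using h by (simp add: affine_comb_def half_unique act_add_right)

lemma affine_comb_half_cancel:
  assumes "x \<in> carrier X" "y \<in> carrier X" "y' \<in> carrier X"
    and "affine_comb x h y = affine_comb x h y'"
  shows "y = y'"
proof -
  \<comment> \<open>Doubling undoes \<open>\<phi> h\<close>, which is therefore injective.\<close>
  have double: "\<phi> h z \<oplus>\<^bsub>X\<^esub> \<phi> h z = z" if "z \<in> carrier X" for z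
    using act_add_left[of h h z] h that by simp
  have "\<phi> h (x \<oplus>\<^bsub>X\<^esub> y) = \<phi> h (x \<oplus>\<^bsub>X\<^esub> y')" using assms by (simp add: affine_comb_half)
  then have "x \<oplus>\<^bsub>X\<^esub> y = x \<oplus>\<^bsub>X\<^esub> y'" by (metis assms(1-3) double X.a_closed)
  then show ?thesis using assms(1-3) by simp
qed

lemma affine_comb_half_commute:
  assumes "x\<^sub>1 \<in> carrier X" "x\<^sub>2 \<in> carrier X" "y\<^sub>1 \<in> carrier X" "y\<^sub>2 \<in> carrier X"
    and a: "a \<in> carrier A"
  shows "affine_comb (affine_comb x\<^sub>1 a y\<^sub>1) h (affine_comb x\<^sub>2 a y\<^sub>2)
    = affine_comb (affine_comb x\<^sub>1 h x\<^sub>2) a (affine_comb y\<^sub>1 h y\<^sub>2)"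
proof -
  \<comment> \<open>Centrality of \<open>h\<close> is used here, carried over to the action.\<close>
  have swap: "\<phi> b (\<phi> h z) = \<phi> h (\<phi> b z)" if "b \<in> carrier A" "z \<in> carrier X" for b z
    using half_central[OF h that(1)] h that by (metis act_mult)
  have "affine_comb (affine_comb x\<^sub>1 a y\<^sub>1) h (affine_comb x\<^sub>2 a y\<^sub>2)
      = \<phi> h (affine_comb x\<^sub>1 a y\<^sub>1 \<oplus>\<^bsub>X\<^esub> affine_comb x\<^sub>2 a y\<^sub>2)"
    using assms by (simp add: affine_comb_half)
  \<comment> \<open>For a fixed scalar \<open>a\<close>, the combination is additive in the pair of
    its points.\<close>
  also have "\<dots> = \<phi> h (affine_comb (x\<^sub>1 \<oplus>\<^bsub>X\<^esub> x\<^sub>2) a (y\<^sub>1 \<oplus>\<^bsub>X\<^esub> y\<^sub>2))"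
    using assms by (simp add: affine_comb_def act_add_right X.a_ac)
  \<comment> \<open>By \<open>swap\<close>, \<open>\<phi> h\<close> passes through both coefficients
    1 - a and a.\<close>
  also have "\<dots> = affine_comb (\<phi> h (x\<^sub>1 \<oplus>\<^bsub>X\<^esub> x\<^sub>2)) a (\<phi> h (y\<^sub>1 \<oplus>\<^bsub>X\<^esub> y\<^sub>2))"
    using assms h by (simp add: affine_comb_def act_add_right swap)
  finally show ?thesis using assms by (simp add: affine_comb_half)
qed

end

end

theorem theorem5p1:
  fixes A :: "('a, 'm) ring_scheme" (structure)
    and X :: "('b, 'n) ring_scheme"
    and \<phi> :: "'a \<Rightarrow> 'b \<Rightarrow> 'b"
    and p :: "'a \<Rightarrow> 'a \<Rightarrow> 'a \<Rightarrow> 'a"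
    and q :: "'b \<Rightarrow> 'a \<Rightarrow> 'b \<Rightarrow> 'b"
  assumes "ring_module A X \<phi>"
    and "\<one> \<oplus> \<one> \<in> Units A"
    and "\<And>a b c. \<lbrakk>a \<in> carrier A; b \<in> carrier A; c \<in> carrier A\<rbrakk> \<Longrightarrow>
      p a b c = a \<oplus> b \<otimes> c \<ominus> b \<otimes> a"
    and "\<And>x a y. \<lbrakk>x \<in> carrier X; a \<in> carrier A; y \<in> carrier X\<rbrakk> \<Longrightarrow>
      q x a y = \<phi> (\<one> \<ominus> a) x \<oplus>\<^bsub>X\<^esub> \<phi> a y"
  shows "affine_mobi_space (carrier A) p \<zero> (inv (\<one> \<oplus> \<one>)) \<one> (carrier X) q"
proof -
  interpret M: ring_module A X \<phi> by fact
  interpret R: ring_module A A "\<lambda>a. \<lambda>x\<in>carrier A. a \<otimes> x" by (rule M.regular_module)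
  define h where "h = inv (\<one> \<oplus> \<one>)"
  have h: "h \<in> carrier A" "h \<oplus> h = \<one>"
    using assms(2) M.inv_two by (auto simp: h_def)
  have p: "p a b c = a \<oplus> b \<otimes> c \<ominus> b \<otimes> a"
    if "a \<in> carrier A" "b \<in> carrier A" "c \<in> carrier A" for a b c
    using assms(3) that .
  have q: "q x a y = M.affine_comb x a y"
    if "x \<in> carrier X" "a \<in> carrier A" "y \<in> carrier X" for x a y
    using assms(4) that by (simp add: M.affine_comb_def)
  \<comment> \<open>In the regular module the combination is (1 - b)a + bc, which is a + bc -
    ba.\<close>
  have p_comb: "p a b c = R.affine_comb a b c"
    if "a \<in> carrier A" "b \<in> carrier A" "c \<in> carrier A" for a b c
    using that by (simp add: p R.affine_comb_def) algebra
  have "affine_mobi_space (carrier A) p \<zero> h \<one> (carrier X) q"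
  proof
    show "p a b c \<in> carrier A" if "a \<in> carrier A" "b \<in> carrier A" "c \<in> carrier A" for a b c
      using that by (simp add: p)
    show "p \<one> h \<zero> = h" using h by (simp add: p M.half_unique)
    show "p \<zero> a \<one> = a" if "a \<in> carrier A" for a using that by (simp add: p M.minus_eq)
    show "p a b a = a" if "a \<in> carrier A" "b \<in> carrier A" for a b
      using that by (simp add: p_comb R.affine_comb_same)
    show "p a \<zero> b = a" if "a \<in> carrier A" "b \<in> carrier A" for a b
      using that by (simp add: p_comb R.affine_comb_zero)
    show "p b \<one> a = a" if "a \<in> carrier A" "b \<in> carrier A" for a b
      using that by (simp add: p_comb R.affine_comb_one)
    show "b = c" if "a \<in> carrier A" "b \<in> carrier A" "c \<in> carrier A" "p a h b = p a h c" for a b c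
      using R.affine_comb_half_cancel[OF h that(1-3)] that h(1) by (simp add: p_comb)
    show "p a (p b\<^sub>1 b\<^sub>2 b\<^sub>3) c = p (p a b\<^sub>1 c) b\<^sub>2 (p a b\<^sub>3 c)"
      if "a \<in> carrier A" "b\<^sub>1 \<in> carrier A" "b\<^sub>2 \<in> carrier A" "b\<^sub>3 \<in> carrier A" "c \<in> carrier A"
      for a b\<^sub>1 b\<^sub>2 b\<^sub>3 c
      \<comment> \<open>Here \<open>a\<close> and \<open>c\<close> are points, whereas
        \<open>p b\<^sub>1 b\<^sub>2 b\<^sub>3\<close> is a scalar; the instance of \<open>p\<close>
        equates it with the ring expression that appears as scalar in the lemma.\<close>
      using that R.affine_comb_affine_comb[of a c b\<^sub>1 b\<^sub>2 b\<^sub>3] p[of b\<^sub>1 b\<^sub>2 b\<^sub>3] by (simp add: p_comb)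
    show "p (p a\<^sub>1 b c\<^sub>1) h (p a\<^sub>2 b c\<^sub>2) = p (p a\<^sub>1 h a\<^sub>2) b (p c\<^sub>1 h c\<^sub>2)"
      if "a\<^sub>1 \<in> carrier A" "a\<^sub>2 \<in> carrier A" "b \<in> carrier A" "c\<^sub>1 \<in> carrier A" "c\<^sub>2 \<in> carrier A"
      for a\<^sub>1 a\<^sub>2 b c\<^sub>1 c\<^sub>2
      using that h(1) R.affine_comb_half_commute[OF h, of a\<^sub>1 a\<^sub>2 c\<^sub>1 c\<^sub>2 b] by (simp add: p_comb)
    show "q x a y \<in> carrier X" if "x \<in> carrier X" "a \<in> carrier A" "y \<in> carrier X" for x a y
      using that by (simp add: q)
    show "q x \<zero> y = x" if "x \<in> carrier X" "y \<in> carrier X" for x y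
      using that by (simp add: q M.affine_comb_zero)
    show "q y \<one> x = x" if "x \<in> carrier X" "y \<in> carrier X" for x y
      using that by (simp add: q M.affine_comb_one)
    show "q x a x = x" if "x \<in> carrier X" "a \<in> carrier A" for x a
      using that by (simp add: q M.affine_comb_same)
    show "y = y'" if "x \<in> carrier X" "y \<in> carrier X" "y' \<in> carrier X" "q x h y = q x h y'"
      for x y y'
      using M.affine_comb_half_cancel[OF h that(1-3)] that h(1) by (simp add: q)
    show "q (q x a y) b (q x c y) = q x (p a b c) y"
      if "x \<in> carrier X" "y \<in> carrier X" "a \<in> carrier A" "b \<in> carrier A" "c \<in> carrier A"
      for x y a b c
      using that by (simp add: p q M.affine_comb_affine_comb)
    show "q (q x\<^sub>1 a y\<^sub>1) h (q x\<^sub>2 a y\<^sub>2) = q (q x\<^sub>1 h x\<^sub>2) a (q y\<^sub>1 h y\<^sub>2)"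
      if "x\<^sub>1 \<in> carrier X" "x\<^sub>2 \<in> carrier X" "y\<^sub>1 \<in> carrier X" "y\<^sub>2 \<in> carrier X" "a \<in> carrier A"
      for x\<^sub>1 x\<^sub>2 y\<^sub>1 y\<^sub>2 a
      using that h(1) M.affine_comb_half_commute[OF h, of x\<^sub>1 x\<^sub>2 y\<^sub>1 y\<^sub>2 a] by (simp add: q)
  \<comment> \<open>What remains is that 0, \<open>h\<close> and 1 lie in the carrier.\<close>
  qed (use h in simp_all)
  then show ?thesis by (simp add: h_def)
qed

end
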